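(* Let $b_n = f_{231}(\mathrm{Av}_n(123)) = f_{312}(\mathrm{Av}_n(123))$ be the total number of occurrences of the pattern $231$ (equivalently, of $312$) in all permutations in $\mathrm{Av}_n(123)$. Then, as formal power series over $\mathbb{Q}$, $$\sum_{n \geq 0} b_n x^n = \frac{1-3x}{2(1-4x)^{2}} - \frac{4x^2 - 5x + 1}{2(1-4x)^{5/2}}.$$
   Context: Permutations are written in one-line notation. For $p = p_1\cdots p_n \in S_n$ and $q = q_1 \cdots q_k\in S_k$, an occurrence of $q$ in $p$ (as a pattern) is a choice of indices $1 \le i_1 < \dots < i_k \le n$ such that $p_{i_1},\dots,p_{i_k}$ are in the same relative order as $q_1,\dots,q_k$ (i.e. $p_{i_s}<p_{i_t}$ iff $q_s<q_t$). $f_q(p)$ denotes the number of occurrences of $q$ in $p$, and $p$ avoids $q$ if $f_q(p)=0$. $\mathrm{Av}_n(r)$ is the set of permutations in $S_n$ avoiding $r$. For a finite set $\mathcal C$ of permutations, $f_q(\mathcal C)=\sum_{p\in\mathcal C} f_q(p)$. Powers $(1-4x)^{r}$ with $r$ a half-integer denote the binomial series with constant term $1$. *)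

theory Defs
  imports
    "HOL-Combinatorics.Multiset_Permutations"
    "HOL-Computational_Algebra.Formal_Power_Series"
begin

text \<open>
  A permutation in \<open>S\<^sub>n\<close> is represented by its one-line notation, an element of
  \<^term>\<open>permutations_of_set {1..n}\<close>. Positions are counted from 0, so an occurrence of a
  pattern is a strictly increasing list of indices below \<^term>\<open>length p\<close>.
\<close>

definition occurrences :: "nat list \<Rightarrow> nat list \<Rightarrow> nat list set" where
  "occurrences q p = {is. length is = length q \<and> sorted_wrt (<) is \<and> set is \<subseteq> {..<length p} \<and>
     (\<forall>s<length q. \<forall>t<length q. p ! (is ! s) < p ! (is ! t) \<longleftrightarrow> q ! s < q ! t)}"

definition occ_count :: "nat list \<Rightarrow> nat list \<Rightarrow> nat" where
  "occ_count q p = card (occurrences q p)"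

definition avoids :: "nat list \<Rightarrow> nat list \<Rightarrow> bool" where
  "avoids p q \<longleftrightarrow> occ_count q p = 0"

definition Av :: "nat \<Rightarrow> nat list \<Rightarrow> nat list set" where
  "Av n r = {p \<in> permutations_of_set {1..n}. avoids p r}"

definition total_occ :: "nat list \<Rightarrow> nat list set \<Rightarrow> nat" where
  "total_occ q C = (\<Sum>p\<in>C. occ_count q p)"

text \<open>
  The binomial series \<open>(1 - 4x)\<^sup>r\<close> with constant term 1, where \<^term>\<open>fps_binomial r\<close>
  is the series \<open>(1 + x)\<^sup>r\<close>.
\<close>

definition one_minus_4x_powr :: "rat \<Rightarrow> rat fps" where
  "one_minus_4x_powr r = fps_binomial r oo (- 4 * fps_X)"

text \<open>
  Cardinalities and sums over infinite sets are 0, so the counts above rely on finiteness.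
\<close>

lemma finite_occurrences [simp]: "finite (occurrences q p)"
  by (rule finite_subset[OF _ finite_lists_length_eq[of "{..<length p}" "length q"]])
     (auto simp: occurrences_def)

lemma finite_Av [simp]: "finite (Av n r)"
  by (simp add: Av_def)

lemma avoids_iff: "avoids p q \<longleftrightarrow> occurrences q p = {}"
  by (simp add: avoids_def occ_count_def)

end

theory Submission
  imports Defs
begin

text \<open>
  Reverse-complement fixes 123 and exchanges 231 with 312, so 312 suffices. Every 123-avoiding
  permutation of length \<open>n + 1\<close> arises uniquely from one of length \<open>n\<close> by prepending a value \<open>v\<close> that
  exceeds the largest entry \<open>m\<close> occurring as the bottom of an ascending pair. The new occurrences of
  312 are the ascending pairs below \<open>v\<close>; let \<open>A(v)\<close> be their number. For the generating function of
  all occurrences among the descendants of \<open>p\<close> in this tree, only four statistics of \<open>p\<close> matter: the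
  number \<open>k = n + 1 - m\<close> of admissible values, the number of 312s, the sum of \<open>A(v)\<close> over
  \<open>m < v \<le> n\<close>, and \<open>A(n + 1)\<close>. In these statistics it has an explicit form, a multiple of the \<open>k\<close>-th
  power of the Catalan series, which is verified by induction on \<open>k\<close>. Evaluating it at the empty
  permutation gives the result.
\<close>

subsection \<open>Growing 123-avoiding permutations from the front\<close>

text \<open>This is the \<open>A(v)\<close> of the overview. Bounding the top by \<open>v\<close>
  also bounds the bottom, so each such pair completes a 312 when \<open>v\<close> is put in
  front.\<close>

definition ascents_below :: "nat \<Rightarrow> nat list \<Rightarrow> nat" where
  "ascents_below v p = card {(j, k). j < k \<and> k < length p \<and> p ! j < p ! k \<and> p ! k < v}"

text \<open>The number \<open>m\<close> of the overview. The default 0 for lists without an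
  ascending pair lies below every value of a permutation, so all values are then admissible.\<close>

fun max_bottom :: "nat list \<Rightarrow> nat" where
  "max_bottom [] = 0"
| "max_bottom (a # p) = (if \<exists>b\<in>set p. a < b then max a (max_bottom p) else max_bottom p)"

text \<open>The order-preserving relabelling that frees the value \<open>v\<close>.\<close>

definition shift :: "nat \<Rightarrow> nat \<Rightarrow> nat" where
  "shift v a = (if v \<le> a then Suc a else a)"

definition insert_front :: "nat \<Rightarrow> nat list \<Rightarrow> nat list" where
  "insert_front v p = v # map (shift v) p"

lemma strict_mono_shift: "strict_mono (shift v)"
  by (auto simp: strict_mono_def shift_def)

section \<open>Pattern occurrences and the effect of a new first entry\<close>

lemma occurrences_map:
  assumes "strict_mono f"
  shows "occurrences q (map f p) = occurrences q p"
proof -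
  have "map f p ! (is ! s) < map f p ! (is ! t) \<longleftrightarrow> p ! (is ! s) < p ! (is ! t)"
    if "set is \<subseteq> {..<length p}" "s < length is" "t < length is" for "is" s t
  proof -
    have "is ! s < length p" "is ! t < length p"
      using that nth_mem by blast+
    thus ?thesis using assms by (simp add: strict_mono_less)
  qed
  thus ?thesis unfolding occurrences_def by (intro Collect_cong) auto
qed

text \<open>The nine comparisons between pattern positions reduce to a chain of two inequalities;
  the others follow by transitivity.\<close>

lemma occurrences_312:
  "occurrences [3,1,2] p =
    (\<lambda>(i, j, k). [i, j, k]) ` {(i, j, k). i < j \<and> j < k \<and> k < length p \<and> p ! j < p ! k \<and> p ! k < p ! i}"
  by (fastforce simp: occurrences_def All_less_Suc numeral_eq_Suc length_Suc_conv image_iff)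

lemma occurrences_123:
  "occurrences [1,2,3] p =
    (\<lambda>(i, j, k). [i, j, k]) ` {(i, j, k). i < j \<and> j < k \<and> k < length p \<and> p ! i < p ! j \<and> p ! j < p ! k}"
  by (fastforce simp: occurrences_def All_less_Suc numeral_eq_Suc length_Suc_conv image_iff)

lemma finite_index_pairs [simp]: "finite {(j, k). j < k \<and> k < length p \<and> P j k}"
  by (rule finite_subset[of _ "{..<length p} \<times> {..<length p}"]) auto

text \<open>Occurrences either avoid position 0, and then are shifted occurrences in
  \<open>p\<close>, or use the new entry as the 3, and then are given by an ascending pair below
  \<open>a\<close>.\<close>

lemma occ_count_312_Cons:
  "occ_count [3,1,2] (a # p) = occ_count [3,1,2] p + ascents_below a p"
proof -
  let ?B = "{(j, k). j < k \<and> k < length p \<and> p ! j < p ! k \<and> p ! k < a}"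
  have "occurrences [3,1,2] (a # p) =
      map Suc ` occurrences [3,1,2] p \<union> (\<lambda>(j, k). [0, Suc j, Suc k]) ` ?B" (is "?L = ?R1 \<union> ?R2")
  proof (intro equalityI subsetI)
    fix xs assume "xs \<in> ?L"
    then obtain i j k where xs: "xs = [i, j, k]" "i < j" "j < k" "k < length (a # p)"
      "(a # p) ! j < (a # p) ! k" "(a # p) ! k < (a # p) ! i"
      unfolding occurrences_312 by auto
    obtain j' where j: "j = Suc j'" using xs(2) by (cases j) auto
    obtain k' where k: "k = Suc k'" using xs(3) by (cases k) auto
    show "xs \<in> ?R1 \<union> ?R2"
    proof (cases i)
      case 0
      hence "xs \<in> ?R2" using xs j k by (auto simp: image_iff)
      thus ?thesis ..
    next
      case (Suc i')
      hence "xs = map Suc [i', j', k']" "[i', j', k'] \<in> occurrences [3,1,2] p"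
        using xs j k unfolding occurrences_312 by (auto simp: image_iff)
      thus ?thesis by blast
    qed
  next
    fix xs assume "xs \<in> ?R1 \<union> ?R2"
    thus "xs \<in> ?L"
      unfolding occurrences_312 by (force simp: image_iff)
  qed
  moreover have "?R1 \<inter> ?R2 = {}"
    by (auto simp: occurrences_def)
  moreover have "card ?R1 = occ_count [3,1,2] p"
    unfolding occ_count_def by (rule card_image) (auto intro: inj_on_subset[OF inj_mapI])
  moreover have "card ?R2 = ascents_below a p"
    unfolding ascents_below_def by (rule card_image) (auto simp: inj_on_def)
  ultimately show ?thesis
    by (simp add: occ_count_def card_Un_disjoint)
qed

lemma ascents_below_Cons:
  "ascents_below v (a # p) = card {k. k < length p \<and> a < p ! k \<and> p ! k < v} + ascents_below v p"
proof -
  let ?K = "{k. k < length p \<and> a < p ! k \<and> p ! k < v}"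
  let ?B = "\<lambda>q. {(j, k). j < k \<and> k < length q \<and> q ! j < q ! k \<and> q ! k < v}"
  have "?B (a # p) = (\<lambda>k. (0, Suc k)) ` ?K \<union> map_prod Suc Suc ` ?B p"
    (is "_ = ?R1 \<union> ?R2")
  proof (intro equalityI subsetI)
    fix w assume "w \<in> ?B (a # p)"
    then obtain j k where w: "w = (j, k)" "j < k" "k < length (a # p)"
      "(a # p) ! j < (a # p) ! k" "(a # p) ! k < v" by auto
    obtain k' where k: "k = Suc k'" using w(2) by (cases k) auto
    show "w \<in> ?R1 \<union> ?R2"
      using w k by (cases j) (auto simp: image_iff)
  qed auto
  moreover have "?R1 \<inter> ?R2 = {}" by auto
  moreover have "card ?R1 = card ?K"
    by (rule card_image) (auto simp: inj_on_def)
  moreover have "card ?R2 = card (?B p)"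
    by (rule card_image) (auto simp: inj_on_def)
  ultimately show ?thesis
    by (simp add: ascents_below_def card_Un_disjoint)
qed

lemma card_indices_between:
  assumes "distinct p" "{a<..<v} \<subseteq> set p"
  shows "card {k. k < length p \<and> a < p ! k \<and> p ! k < v} = v - Suc a"
proof -
  let ?K = "{k. k < length p \<and> a < p ! k \<and> p ! k < v}"
  have "(!) p ` ?K = {a<..<v}"
  proof (intro equalityI subsetI)
    fix b assume b: "b \<in> {a<..<v}"
    then obtain k where "k < length p" "p ! k = b"
      using assms(2) by (metis in_set_conv_nth subsetD)
    thus "b \<in> (!) p ` ?K" using b by auto
  qed auto
  moreover have "inj_on ((!) p) ?K"
    using assms(1) by (auto simp: inj_on_def nth_eq_iff_index_eq)
  ultimately have "card {a<..<v} = card ?K"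
    using card_image[of "(!) p" ?K] by simp
  thus ?thesis by simp
qed

text \<open>The strict form also covers the default 0, where no maximum is attained. It says exactly
  when a new first entry \<open>a\<close> would start a 123.\<close>

lemma less_max_bottom_iff:
  "a < max_bottom p \<longleftrightarrow> (\<exists>j k. j < k \<and> k < length p \<and> a < p ! j \<and> p ! j < p ! k)"
proof (induction p)
  case (Cons b p)
  have "(\<exists>j k. j < k \<and> k < length (b # p) \<and> a < (b # p) ! j \<and> (b # p) ! j < (b # p) ! k) \<longleftrightarrow>
      (a < b \<and> (\<exists>c\<in>set p. b < c)) \<or> (\<exists>j k. j < k \<and> k < length p \<and> a < p ! j \<and> p ! j < p ! k)"
    (is "?L \<longleftrightarrow> ?R1 \<or> ?R2")
  proof
    assume ?L
    then obtain j k where jk: "j < k" "k < length (b # p)" "a < (b # p) ! j" "(b # p) ! j < (b # p) ! k"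
      by blast
    obtain k' where k: "k = Suc k'" using jk(1) by (cases k) auto
    show "?R1 \<or> ?R2"
      using jk k by (cases j) (auto intro: nth_mem)
  next
    assume "?R1 \<or> ?R2"
    thus ?L
    proof
      assume ?R1
      then obtain k where "a < b" "k < length p" "b < p ! k" by (auto simp: in_set_conv_nth)
      thus ?L by (intro exI[of _ 0] exI[of _ "Suc k"]) auto
    next
      assume ?R2
      then obtain j k where "j < k" "k < length p" "a < p ! j" "p ! j < p ! k" by blast
      thus ?L by (intro exI[of _ "Suc j"] exI[of _ "Suc k"]) auto
    qed
  qed
  thus ?case using Cons.IH by auto
qed simp

lemma avoids_123_Cons:
  "avoids (a # p) [1,2,3] \<longleftrightarrow> avoids p [1,2,3] \<and> max_bottom p \<le> a"
proof -
  let ?T = "\<lambda>p. \<exists>i j k. i < j \<and> j < k \<and> k < length p \<and> p ! i < p ! j \<and> p ! j < p ! k"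
  have *: "avoids p [1,2,3] \<longleftrightarrow> \<not> ?T p" for p
    unfolding avoids_iff occurrences_123 by auto
  have "?T (a # p) \<longleftrightarrow> ?T p \<or> a < max_bottom p"
  proof
    assume "?T (a # p)"
    then obtain i j k where ijk: "i < j" "j < k" "k < length (a # p)"
      "(a # p) ! i < (a # p) ! j" "(a # p) ! j < (a # p) ! k" by blast
    obtain j' where j: "j = Suc j'" using ijk(1) by (cases j) auto
    obtain k' where k: "k = Suc k'" using ijk(2) by (cases k) auto
    show "?T p \<or> a < max_bottom p"
      using ijk j k unfolding less_max_bottom_iff by (cases i) auto
  next
    assume "?T p \<or> a < max_bottom p"
    thus "?T (a # p)"
    proof
      assume "?T p"
      then obtain i j k where "i < j" "j < k" "k < length p" "p ! i < p ! j" "p ! j < p ! k" by blast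
      thus ?thesis by (intro exI[of _ "Suc i"] exI[of _ "Suc j"] exI[of _ "Suc k"]) auto
    next
      assume "a < max_bottom p"
      then obtain j k where "j < k" "k < length p" "a < p ! j" "p ! j < p ! k"
        unfolding less_max_bottom_iff by blast
      thus ?thesis by (intro exI[of _ 0] exI[of _ "Suc j"] exI[of _ "Suc k"]) auto
    qed
  qed
  thus ?thesis unfolding * by auto
qed

text \<open>Fixing 0 matters because 0 is the default of \<open>max_bottom\<close>.\<close>

lemma max_bottom_map:
  assumes "strict_mono f" "f 0 = (0::nat)"
  shows "max_bottom (map f p) = f (max_bottom p)"
  by (induction p) (use assms in \<open>auto simp: strict_mono_less max_def strict_mono_less_eq\<close>)

lemma Av_iff: "p \<in> Av n r \<longleftrightarrow> distinct p \<and> set p = {1..n} \<and> avoids p r"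
  by (auto simp: Av_def permutations_of_set_def)

lemma length_Av: "p \<in> Av n r \<Longrightarrow> length p = n"
  by (metis Av_iff card_atLeastAtMost diff_Suc_1 distinct_card)

lemma max_bottom_le:
  assumes "set p \<subseteq> {..n}"
  shows "max_bottom p \<le> n"
  using assms by (induction p) auto

lemma avoids_map: "strict_mono f \<Longrightarrow> avoids (map f p) q \<longleftrightarrow> avoids p q"
  by (simp add: avoids_iff occurrences_map)

lemma set_map_shift:
  assumes "v \<in> {1..Suc n}"
  shows "shift v ` {1..n} = {1..Suc n} - {v}"
proof (intro equalityI subsetI)
  fix a assume a: "a \<in> {1..Suc n} - {v}"
  show "a \<in> shift v ` {1..n}"
    by (rule image_eqI[of _ _ "if v < a then a - 1 else a"]) (use a assms in \<open>auto simp: shift_def\<close>)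
qed (use assms in \<open>auto simp: shift_def\<close>)

text \<open>One level of the generating tree: the first entry of the result reveals
  \<open>v\<close>, and injectivity of \<open>shift v\<close> then recovers
  \<open>p\<close>.\<close>

lemma bij_betw_insert_front:
  "bij_betw (\<lambda>(p, v). insert_front v p)
    (SIGMA p:Av n [1,2,3]. {max_bottom p<..Suc n}) (Av (Suc n) [1,2,3])"
  unfolding bij_betw_def
proof
  have "inj (shift v)" for v
    using strict_mono_shift strict_mono_imp_inj_on by blast
  thus "inj_on (\<lambda>(p, v). insert_front v p) (SIGMA p:Av n [1,2,3]. {max_bottom p<..Suc n})"
    by (auto simp: inj_on_def insert_front_def)
next
  show "(\<lambda>(p, v). insert_front v p) ` (SIGMA p:Av n [1,2,3]. {max_bottom p<..Suc n}) = Av (Suc n) [1,2,3]"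
    (is "?f ` ?A = ?B")
  proof (intro equalityI subsetI)
    fix r assume "r \<in> ?f ` ?A"
    then obtain p v where p: "p \<in> Av n [1,2,3]" "max_bottom p < v" "v \<le> Suc n" and r: "r = v # map (shift v) p"
      by (auto simp: insert_front_def)
    have "set (map (shift v) p) = {1..Suc n} - {v}"
      using p set_map_shift[of v n] by (auto simp: Av_iff)
    moreover have "distinct (map (shift v) p)"
      using p strict_mono_imp_inj_on[OF strict_mono_shift] by (auto simp: Av_iff distinct_map)
    moreover have "avoids r [1,2,3]"
      using p unfolding r avoids_123_Cons
      by (auto simp: Av_iff avoids_map strict_mono_shift max_bottom_map shift_def)
    ultimately show "r \<in> ?B"
      using p unfolding r Av_iff by auto
  next
    fix r assume r: "r \<in> ?B"
    then obtain v t where vt: "r = v # t"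
      by (cases r) (auto simp: Av_iff)
    have v: "v \<in> {1..Suc n}" and t: "set t = {1..Suc n} - {v}" "distinct t" "avoids t [1,2,3]" "max_bottom t \<le> v"
      using r unfolding vt Av_iff avoids_123_Cons by auto
    \<comment> \<open>Deleting the first entry and closing the gap at \<open>v\<close> inverts the
      insertion.\<close>
    define p where "p = map (inv (shift v)) t"
    have inj: "inj (shift v)"
      using strict_mono_shift strict_mono_imp_inj_on by blast
    have tp: "t = map (shift v) p"
    proof -
      have "shift v (inv (shift v) a) = a" if "a \<in> set t" for a
      proof -
        have "a \<in> range (shift v)" using that t set_map_shift[OF v] by blast
        thus ?thesis by (rule f_inv_into_f)
      qed
      thus ?thesis by (simp add: p_def map_idI)
    qed
    have "shift v ` set p = shift v ` {1..n}"
      using t set_map_shift[OF v] by (simp add: tp)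
    hence "set p = {1..n}"
      using inj by (simp add: inj_image_eq_iff)
    moreover have "distinct p" "avoids p [1,2,3]"
      using t by (auto simp: tp distinct_map avoids_map strict_mono_shift)
    moreover have "max_bottom p < v"
    proof -
      \<comment> \<open>The weak bound becomes strict because \<open>shift v\<close> never takes the
        value \<open>v\<close>: from \<open>v\<close> on it moves everything up by one.\<close>
      have "shift v (max_bottom p) \<le> v"
        using t(4) v by (simp add: tp max_bottom_map[OF strict_mono_shift] shift_def[of v 0])
      thus ?thesis by (simp add: shift_def split: if_splits)
    qed
    ultimately have "(p, v) \<in> ?A"
      using v by (auto simp: Av_iff)
    moreover have "r = ?f (p, v)"
      by (simp add: vt tp insert_front_def)
    ultimately show "r \<in> ?f ` ?A" by blast
  qed
qed

text \<open>Since \<open>w < v\<close>, a relabelled entry is below \<open>v\<close> iff the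
  original is below \<open>v - 1\<close>: entries from \<open>w\<close> on gain one, and smaller
  ones satisfy both bounds.\<close>

lemma ascents_below_map_shift:
  assumes "w < v"
  shows "ascents_below v (map (shift w) p) = ascents_below (v - 1) p"
proof -
  have "{(j, k). j < k \<and> k < length p \<and> shift w (p ! j) < shift w (p ! k) \<and> shift w (p ! k) < v} =
      {(j, k). j < k \<and> k < length p \<and> p ! j < p ! k \<and> p ! k < v - 1}"
    using assms by (auto simp: shift_def split: if_splits)
  moreover have "(map (shift w) p ! j < map (shift w) p ! k \<and> map (shift w) p ! k < v) \<longleftrightarrow>
      (shift w (p ! j) < shift w (p ! k) \<and> shift w (p ! k) < v)" if "j < k" "k < length p" for j k
    using that by simp
  ultimately show ?thesis
    unfolding ascents_below_def by (smt (verit, best) Collect_cong length_map case_prod_conv split_cong)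
qed

section \<open>Change of the four statistics under insertion\<close>

context
  fixes n p
  assumes p: "p \<in> Av n [1,2,3]"
begin

lemma length_insert_front: "length (insert_front w p) = Suc n"
  using length_Av[OF p] by (simp add: insert_front_def)

lemma occ_count_312_insert_front:
  assumes "w \<in> {1..Suc n}"
  shows "occ_count [3,1,2] (insert_front w p) = occ_count [3,1,2] p + ascents_below w p"
proof -
  have "ascents_below w (map (shift w) p) = ascents_below w p"
    unfolding ascents_below_def by (rule arg_cong[where f = card]) (auto simp: shift_def split: if_splits)
  thus ?thesis
    unfolding insert_front_def occ_count_312_Cons
    by (simp only: occ_count_def occurrences_map[OF strict_mono_shift])
qed

text \<open>The new entry is the bottom of an ascending pair iff \<open>Suc n\<close> stands behind
  it, that is, iff \<open>w\<close> is not itself \<open>Suc n\<close>; in that case it beats the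
  old maximum.\<close>

lemma max_bottom_insert_front:
  assumes "max_bottom p < w" "w \<le> Suc n"
  shows "max_bottom (insert_front w p) = (if w \<le> n then w else max_bottom p)"
proof -
  have "set (map (shift w) p) = {1..Suc n} - {w}"
    using p set_map_shift[of w n] assms by (simp add: Av_iff)
  hence "(\<exists>b\<in>set (map (shift w) p). w < b) \<longleftrightarrow> w \<le> n"
    using assms by (auto intro!: bexI[of _ "Suc n"])
  moreover have "max_bottom (map (shift w) p) = max_bottom p"
    using assms by (simp add: max_bottom_map[OF strict_mono_shift] shift_def)
  ultimately show ?thesis
    using assms by (simp only: insert_front_def max_bottom.simps)
qed

text \<open>Every value strictly between \<open>w\<close> and \<open>v\<close> occurs behind
  \<open>w\<close> and is the top of one new pair; the old pairs are counted after
  relabelling.\<close>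

lemma ascents_below_insert_front:
  assumes "w \<in> {1..Suc n}" "w < v" "v \<le> Suc (Suc n)"
  shows "ascents_below v (insert_front w p) = ascents_below (v - 1) p + (v - Suc w)"
proof -
  let ?q = "map (shift w) p"
  have set: "set ?q = {1..Suc n} - {w}"
    using p set_map_shift[OF assms(1)] by (simp add: Av_iff)
  have "card {k. k < length ?q \<and> w < ?q ! k \<and> ?q ! k < v} = v - Suc w"
  proof (rule card_indices_between)
    show "distinct ?q"
      using p strict_mono_imp_inj_on[OF strict_mono_shift] by (auto simp: Av_iff distinct_map)
    show "{w<..<v} \<subseteq> set ?q"
      unfolding set using assms by auto
  qed
  thus ?thesis
    using ascents_below_map_shift[OF assms(2)] by (simp only: insert_front_def ascents_below_Cons add.commute)
qed

lemma ascents_below_insert_front_max: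
  assumes "v \<le> Suc n"
  shows "ascents_below v (insert_front (Suc n) p) = ascents_below v p"
proof -
  have "map (shift (Suc n)) p = p"
    using p by (auto simp: Av_iff shift_def intro!: map_idI)
  moreover have "{k. k < length p \<and> Suc n < p ! k \<and> p ! k < v} = {}"
    using assms by auto
  ultimately show ?thesis
    by (simp add: insert_front_def ascents_below_Cons)
qed

end

subsection \<open>Reverse-complement\<close>

text \<open>One operation serves three purposes: on permutations (\<open>Suc n\<close>), on patterns
  (4 for length 3), and on 0-based index lists (\<open>length p - 1\<close>), which it keeps
  increasing. It is an involution as long as all entries are at most \<open>n\<close>, so that the
  subtraction does not truncate.\<close>

definition rev_compl :: "nat \<Rightarrow> nat list \<Rightarrow> nat list" where
  "rev_compl n p = map (\<lambda>a. n - a) (rev p)"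

lemma rev_compl_rev_compl:
  assumes "set p \<subseteq> {..n}"
  shows "rev_compl n (rev_compl n p) = p"
  using assms by (auto simp: rev_compl_def rev_map intro!: map_idI)

lemma rev_compl_nth:
  "i < length p \<Longrightarrow> rev_compl n p ! i = n - p ! (length p - Suc i)"
  by (simp add: rev_compl_def rev_nth)

text \<open>Complementing reverses the comparisons in \<open>p\<close> and in \<open>q\<close>
  alike, and the reversal of positions is matched by the transformed index list.\<close>

lemma rev_compl_occurrence:
  assumes p: "set p \<subseteq> {..n}" and q: "set q \<subseteq> {..k}" and "is \<in> occurrences q p"
  shows "rev_compl (length p - 1) is \<in> occurrences (rev_compl k q) (rev_compl n p)"
proof -
  let ?l = "length p" and ?m = "length q"
  have len: "length is = ?m" and sorted: "sorted_wrt (<) is" and set: "set is \<subseteq> {..<?l}"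
    and occ: "\<And>s t. s < ?m \<Longrightarrow> t < ?m \<Longrightarrow> p ! (is ! s) < p ! (is ! t) \<longleftrightarrow> q ! s < q ! t"
    using assms(3) by (auto simp: occurrences_def)
  let ?is = "rev_compl (?l - 1) is"
  have lt: "is ! s < ?l" if "s < ?m" for s
    using that set len nth_mem by force
  have nth: "?is ! s = ?l - 1 - is ! (?m - Suc s)" if "s < ?m" for s
    using that by (simp add: rev_compl_nth len)
  have lt': "?is ! s < ?l" if "s < ?m" for s
  proof -
    have "is ! (?m - Suc s) < ?l" using lt that by simp
    thus ?thesis using nth[OF that] by simp
  qed
  have nth': "rev_compl n p ! (?is ! s) = n - p ! (is ! (?m - Suc s))" if "s < ?m" for s
  proof -
    have "is ! (?m - Suc s) < ?l" using lt that by simp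
    hence "?l - Suc (?is ! s) = is ! (?m - Suc s)"
      using nth[OF that] by simp
    thus ?thesis using lt'[OF that] by (simp add: rev_compl_nth)
  qed
  have "sorted_wrt (<) ?is"
  proof (subst sorted_wrt_iff_nth_less, intro allI impI)
    fix s t assume st: "s < t" "t < length ?is"
    hence m: "s < ?m" "t < ?m" by (simp_all add: rev_compl_def len)
    have "is ! (?m - Suc t) < is ! (?m - Suc s)"
      using sorted st m len by (simp add: sorted_wrt_iff_nth_less)
    moreover have "is ! (?m - Suc s) < ?l" using lt m by simp
    ultimately show "?is ! s < ?is ! t"
      unfolding nth[OF m(1)] nth[OF m(2)] by simp
  qed
  moreover have "set ?is \<subseteq> {..<length (rev_compl n p)}"
  proof
    fix i assume "i \<in> set ?is"
    then obtain s where "s < ?m" "?is ! s = i"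
      by (metis in_set_conv_nth len length_map length_rev rev_compl_def)
    thus "i \<in> {..<length (rev_compl n p)}"
      using lt' by (auto simp: rev_compl_def[of n])
  qed
  moreover have "rev_compl n p ! (?is ! s) < rev_compl n p ! (?is ! t) \<longleftrightarrow>
      rev_compl k q ! s < rev_compl k q ! t" if "s < ?m" "t < ?m" for s t
  proof -
    have "p ! (is ! (?m - Suc s)) \<le> n" "p ! (is ! (?m - Suc t)) \<le> n"
      using that subsetD[OF p nth_mem[OF lt]] by simp_all
    moreover have "q ! (?m - Suc s) \<le> k" "q ! (?m - Suc t) \<le> k"
      using that subsetD[OF q nth_mem] by simp_all
    moreover have "p ! (is ! (?m - Suc t)) < p ! (is ! (?m - Suc s)) \<longleftrightarrow> q ! (?m - Suc t) < q ! (?m - Suc s)"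
      using that by (intro occ) simp_all
    ultimately show ?thesis
      unfolding nth'[OF that(1)] nth'[OF that(2)] rev_compl_nth[OF that(1)] rev_compl_nth[OF that(2)]
      by arith
  qed
  ultimately show ?thesis
    by (simp add: occurrences_def rev_compl_def len)
qed

lemma occ_count_rev_compl:
  assumes p: "set p \<subseteq> {..n}" and q: "set q \<subseteq> {..k}"
  shows "occ_count (rev_compl k q) (rev_compl n p) = occ_count q p"
proof -
  have "bij_betw (rev_compl (length p - 1)) (occurrences q p) (occurrences (rev_compl k q) (rev_compl n p))"
  proof (rule bij_betw_byWitness[where f' = "rev_compl (length p - 1)"])
    have *: "rev_compl (length p - 1) (rev_compl (length p - 1) is) = is" if "set is \<subseteq> {..<length p}" for "is"
      using that by (intro rev_compl_rev_compl) force
    show "\<forall>is\<in>occurrences q p. rev_compl (length p - 1) (rev_compl (length p - 1) is) = is"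
      using * by (auto simp: occurrences_def)
    show "\<forall>is\<in>occurrences (rev_compl k q) (rev_compl n p).
        rev_compl (length p - 1) (rev_compl (length p - 1) is) = is"
      using * by (auto simp: occurrences_def rev_compl_def[of n])
    show "rev_compl (length p - 1) ` occurrences q p \<subseteq> occurrences (rev_compl k q) (rev_compl n p)"
      using rev_compl_occurrence[OF assms] by blast
    have "set (rev_compl n p) \<subseteq> {..n}" "set (rev_compl k q) \<subseteq> {..k}"
      by (auto simp: rev_compl_def)
    moreover have "length (rev_compl n p) = length p"
      by (simp add: rev_compl_def)
    ultimately show "rev_compl (length p - 1) ` occurrences (rev_compl k q) (rev_compl n p) \<subseteq> occurrences q p"
      using rev_compl_occurrence[of "rev_compl n p" n "rev_compl k q" k] p q
      by (auto simp: rev_compl_rev_compl)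
  qed
  thus ?thesis by (simp add: occ_count_def bij_betw_same_card)
qed

lemma bij_betw_rev_compl_Av:
  assumes "set r \<subseteq> {..k}"
  shows "bij_betw (rev_compl (Suc n)) (Av n r) (Av n (rev_compl k r))"
proof -
  have *: "rev_compl (Suc n) p \<in> Av n (rev_compl k r)" if "p \<in> Av n r" "set r \<subseteq> {..k}" for p r
  proof -
    have "(\<lambda>a. Suc n - a) ` {1..n} = {1..n}"
    proof (intro equalityI subsetI)
      fix a assume "a \<in> {1..n}"
      thus "a \<in> (\<lambda>a. Suc n - a) ` {1..n}" by (intro image_eqI[of _ _ "Suc n - a"]) auto
    qed auto
    moreover have "inj_on (\<lambda>a. Suc n - a) {1..n}"
      by (auto simp: inj_on_def)
    ultimately show ?thesis
      using that occ_count_rev_compl[of p "Suc n" r k]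
      by (auto simp: Av_iff rev_compl_def distinct_map avoids_def)
  qed
  have sub: "set p \<subseteq> {..Suc n}" if "p \<in> Av n r" for p r
    using that by (auto simp: Av_iff)
  show ?thesis
  proof (rule bij_betw_byWitness[where f' = "rev_compl (Suc n)"])
    show "rev_compl (Suc n) ` Av n (rev_compl k r) \<subseteq> Av n r"
    proof -
      have "set (rev_compl k r) \<subseteq> {..k}" by (auto simp: rev_compl_def)
      from *[OF _ this] show ?thesis
        using rev_compl_rev_compl[OF assms] by auto
    qed
  qed (use * assms sub rev_compl_rev_compl in auto)
qed

lemma total_occ_231_eq_312:
  "total_occ [2,3,1] (Av n [1,2,3]) = total_occ [3,1,2] (Av n [1,2,3])"
proof -
  have rc: "rev_compl 4 [3,1,2] = [2,3,1]" "rev_compl 4 [1,2,3] = [1,2,3]"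
    by (simp_all add: rev_compl_def)
  have "bij_betw (rev_compl (Suc n)) (Av n [1,2,3]) (Av n [1,2,3])"
    using bij_betw_rev_compl_Av[of "[1,2,3]" 4 n] rc by simp
  hence "total_occ [2,3,1] (Av n [1,2,3]) =
      (\<Sum>p\<in>Av n [1,2,3]. occ_count (rev_compl 4 [3,1,2]) (rev_compl (Suc n) p))"
    unfolding total_occ_def rc by (rule sum.reindex_bij_betw[symmetric])
  also have "\<dots> = total_occ [3,1,2] (Av n [1,2,3])"
    unfolding total_occ_def by (intro sum.cong refl occ_count_rev_compl) (auto simp: Av_iff)
  finally show ?thesis .
qed

subsection \<open>The generating function over descendants\<close>

text \<open>The difference of two consecutive instances of \<open>weight_recurrence\<close>, with
  the common factor \<open>C ^ k\<close> removed. \<open>B2\<close> and \<open>B3\<close> stand for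
  \<open>Suc k choose 2\<close> and \<open>Suc k choose 3\<close>; \<open>E0\<close>,
  \<open>E1\<close>, \<open>E2\<close> are the parts of \<open>weight\<close> free of
  \<open>o1\<close>, \<open>S\<close>, \<open>N\<close> at \<open>k\<close>, \<open>k + 1\<close>,
  \<open>k + 2\<close>, expanded by Pascal's rule.\<close>

lemma weight_step_identity:
  fixes C u x k B2 B3 :: "'a::idom"
  assumes C: "C * (1 + u) = 1 + 2 * u" and x: "x * C^2 = C - 1" and B2: "2 * B2 = k * (k + 1)"
  defines "E0 \<equiv> u^2 * (B3 + u * B2 + u^2 * k)"
    and "E1 \<equiv> u^2 * (B3 + B2 + u * (B2 + (k + 1)) + u^2 * (k + 1))"
    and "E2 \<equiv> u^2 * (B3 + B2 + (B2 + (k + 1)) + u * (B2 + (k + 1) + (k + 2)) + u^2 * (k + 2))"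
  shows "C * (o1 + (C - 1) * (S + g + N * (1 + (k + 1) * u)) + E1)
       - (o1 + (C - 1) * (S + N * (1 + k * u)) + E0)
   = x * (C * (o1 + g + (C - 1) * (S + g + (B2 - k) + (N + k) * (1 + (k + 1) * u)) + E1)
        + C^2 * (o1 + N + (C - 1) * (S + g + N + N * (1 + (k + 2) * u)) + E2)
        - C * (o1 + N + (C - 1) * (S + N + N * (1 + (k + 1) * u)) + E1))"
    (is "?L = x * (C * ?R1 + C^2 * ?R2 - C * ?R3)")
proof -
  define D where "D = C - 1"
  have D: "D * (1 + u) = u" "C = 1 + D"
    using C unfolding D_def by (algebra, simp)
  have xC: "x * C * (1 + 2 * u) = u"
    using C x D by algebra
  \<comment> \<open>\<open>E1\<close> cancels here, and \<open>2 * B2 = k * (k + 1)\<close> produces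
    the factor \<open>1 + 2 * u\<close>, which \<open>x * C\<close> turns into
    \<open>u\<close>.\<close>
  have "?R1 - ?R3 = C * (g - N) + D * (B2 + 2 * B2 * u)"
    unfolding B2 D_def by algebra
  hence "x * (C * ?R1 - C * ?R3) = x * C^2 * (g - N) + x * C * (1 + 2 * u) * (D * B2)"
    by algebra
  also have "\<dots> = D * (g - N) + u * D * B2"
    unfolding x xC D_def by algebra
  finally have 1: "x * (C * ?R1 - C * ?R3) = D * (g - N) + u * D * B2" .
  have 2: "x * (C^2 * ?R2) = D * ?R2"
    using x D by algebra
  have E: "E1 + D * E1 - E0 = D * u * B2 + D * E2"
  proof -
    \<comment> \<open>The difference is linear in \<open>D\<close>; the cofactor of
      \<open>u - D * (1 + u)\<close>, which vanishes, is \<open>E1 - E0\<close> divided by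
      \<open>u\<close>.\<close>
    have "E1 + D * E1 - E0 - (D * u * B2 + D * E2)
        = (u - D * (1 + u)) * (u * B2 + u^2 * (k + 1) + u^3)"
      unfolding E0_def E1_def E2_def by algebra
    thus ?thesis using D(1) by simp
  qed
  have "?L = D * (g - N) + u * D * B2 + D * ?R2"
    using E D by algebra
  thus ?thesis using 1 2 by algebra
qed

text \<open>The recurrence for \<open>m = n\<close>: the sum over \<open>w\<close> is empty, and the
  only child is the one obtained by prepending \<open>Suc n\<close>.\<close>

lemma weight_base_identity:
  fixes C u x :: "'a::idom"
  assumes C: "C * (1 + u) = 1 + 2 * u" and x: "x * C^2 = C - 1"
  shows "C * (o1 + (C - 1) * (N * (1 + u)) + u^2 * (u + u^2))
    = o1 + x * (C^2 * (o1 + N + (C - 1) * (N + N * (1 + 2 * u)) + u^2 * (1 + u * 3 + u^2 * 2)))"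
proof -
  define D where "D = C - 1"
  have D: "D * (1 + u) = u" "C = 1 + D"
    using C unfolding D_def by (algebra, simp)
  have xC: "x * (C^2 * w) = D * w" for w
    using x D by algebra
  have "C * (o1 + D * (N * (1 + u)) + u^2 * (u + u^2))
      - (o1 + D * (o1 + N + D * (N + N * (1 + 2 * u)) + u^2 * (1 + u * 3 + u^2 * 2)))
    = (u - D * (1 + u)) * (D * N + u^2 * (1 + u))"
    unfolding D(2) by algebra
  thus ?thesis
    unfolding xC using D(1) by (simp add: D_def)
qed

text \<open>
  The closed form was found by solving the recurrence \<open>weight_recurrence\<close> below, which is linear in
  \<open>o1\<close>, \<open>S\<close>, \<open>N\<close> and determines the coefficients uniquely. In terms of \<open>s = (1 - 4x)\<^sup>1\<^sup>/\<^sup>2\<close>, \<open>C\<close> is the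
  Catalan series \<open>2 / (1 + s)\<close> and \<open>u = (1 / s - 1) / 2\<close>.
\<close>

definition weight :: "'a::comm_ring_1 \<Rightarrow> 'a \<Rightarrow> nat \<Rightarrow> 'a \<Rightarrow> 'a \<Rightarrow> 'a \<Rightarrow> 'a" where
  "weight C u k o1 S N = C ^ k * (o1 + (C - 1) * (S + N * (1 + of_nat k * u)) +
     u^2 * (of_nat (Suc k choose 3) + u * of_nat (Suc k choose 2) + u^2 * of_nat k))"

text \<open>The statistics become free parameters, so that \<open>m\<close> can vary alone. The
  summand for \<open>w\<close> does not involve \<open>m\<close>; passing from \<open>Suc m\<close>
  to \<open>m\<close> therefore only adds the summand \<open>w = Suc m\<close> and changes the last
  term, as in \<open>weight_step_identity\<close>.\<close>

lemma weight_recurrence: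
  fixes C u x N o1 :: "'a::idom" and A :: "nat \<Rightarrow> 'a"
  assumes C: "C * (1 + u) = 1 + 2 * u" and x: "x * C^2 = C - 1" and "m \<le> n"
  shows "weight C u (Suc n - m) o1 (\<Sum>v\<in>{m<..n}. A v) N = o1 + x *
    ((\<Sum>w\<in>{m<..n}. weight C u (n + 2 - w) (o1 + A w)
        ((\<Sum>v\<in>{w..n}. A v) + of_nat (Suc n - w choose 2)) (N + of_nat (Suc n - w)))
     + weight C u (n + 2 - m) (o1 + N) ((\<Sum>v\<in>{m<..n}. A v) + N) N)"
  using \<open>m \<le> n\<close>
proof (induction m rule: inc_induct)
  case base
  have *: "Suc (Suc 0) choose 3 = 0" "Suc (Suc 0) choose 2 = 1" "3 choose 2 = (3::nat)"
    by (simp_all add: eval_nat_numeral)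
  show ?case
    using weight_base_identity[OF C x, of o1 N]
    by (simp add: weight_def * power2_eq_square)
next
  case (step m)
  define k where "k = n - m"
  have mk: "Suc n - m = Suc k" "n + 2 - m = Suc (Suc k)" "Suc n - Suc m = k" "n + 2 - Suc m = Suc k"
    using step.hyps unfolding k_def by auto
  define S where "S = (\<Sum>v\<in>{Suc m<..n}. A v)"
  have set: "{m<..n} = insert (Suc m) {Suc m<..n}" "{Suc m..n} = insert (Suc m) {Suc m<..n}"
    using step.hyps by auto
  have S: "(\<Sum>v\<in>{m<..n}. A v) = S + A (Suc m)" "(\<Sum>v\<in>{Suc m..n}. A v) = S + A (Suc m)"
    unfolding set S_def by simp_all
  let ?K = "of_nat k :: 'a" and ?B2 = "of_nat (Suc k choose 2) :: 'a" and ?B3 = "of_nat (Suc k choose 3) :: 'a"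
  have B2: "2 * ?B2 = ?K * (?K + 1)"
  proof -
    have "2 * (Suc k choose 2) = k * (k + 1)"
      by (simp add: choose_two)
    hence "(of_nat (2 * (Suc k choose 2)) :: 'a) = of_nat (k * (k + 1))" by (rule arg_cong)
    thus ?thesis by (simp add: algebra_simps)
  qed
  have choose: "Suc (Suc j) choose 2 = (Suc j choose 2) + Suc j" "Suc (Suc j) choose 3 = (Suc j choose 3) + (Suc j choose 2)"
    "Suc j choose 2 = (j choose 2) + j" for j
    by (simp_all add: eval_nat_numeral)
  have k2: "of_nat (k choose 2) = ?B2 - ?K"
    by (simp add: choose(3))
  let ?W = "weight C u"
  let ?R = "\<Sum>w\<in>{Suc m<..n}. ?W (n + 2 - w) (o1 + A w)
        ((\<Sum>v\<in>{w..n}. A v) + of_nat (Suc n - w choose 2)) (N + of_nat (Suc n - w))"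
  have IH: "?W k o1 S N = o1 + x * (?R + ?W (Suc k) (o1 + N) (S + N) N)"
    using step.IH unfolding mk S_def .
  have "?W (Suc k) o1 (S + A (Suc m)) N - ?W k o1 S N =
      x * (?W (Suc k) (o1 + A (Suc m)) (S + A (Suc m) + of_nat (k choose 2)) (N + of_nat k)
        + ?W (Suc (Suc k)) (o1 + N) (S + A (Suc m) + N) N
        - ?W (Suc k) (o1 + N) (S + N) N)"
  proof -
    have *: "of_nat (Suc k) = ?K + 1" "of_nat (Suc (Suc k)) = ?K + 2"
      "of_nat (Suc (Suc k) choose 2) = ?B2 + (?K + 1)"
      "of_nat (Suc (Suc k) choose 3) = ?B3 + ?B2"
      "of_nat (Suc (Suc (Suc k)) choose 2) = ?B2 + (?K + 1) + (?K + 2)"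
      "of_nat (Suc (Suc (Suc k)) choose 3) = ?B3 + ?B2 + (?B2 + (?K + 1))"
      by (simp_all add: choose(1,2) algebra_simps)
    note step = weight_step_identity[OF C x B2, of o1 S "A (Suc m)" N ?B3]
    have pow: "C ^ k * (C * a - b) = C ^ k * (x * (C * a' + C^2 * b' - C * c')) \<Longrightarrow>
       C ^ Suc k * a - C ^ k * b = x * (C ^ Suc k * a' + C ^ Suc (Suc k) * b' - C ^ Suc k * c')" for a b a' b' c'
      by (simp add: algebra_simps power2_eq_square)
    show ?thesis
      unfolding weight_def k2 * by (rule pow, rule arg_cong[where f = "(*) (C ^ k)"], rule step)
  qed
  hence "?W (Suc k) o1 (S + A (Suc m)) N = o1 + x *
      ((?W (Suc k) (o1 + A (Suc m)) (S + A (Suc m) + of_nat (k choose 2)) (N + of_nat k) + ?R)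
        + ?W (Suc (Suc k)) (o1 + N) (S + A (Suc m) + N) N)"
    unfolding IH by (simp add: algebra_simps)
  moreover have "(\<Sum>w\<in>{m<..n}. ?W (n + 2 - w) (o1 + A w)
        ((\<Sum>v\<in>{w..n}. A v) + of_nat (Suc n - w choose 2)) (N + of_nat (Suc n - w)))
     = ?W (Suc k) (o1 + A (Suc m)) (S + A (Suc m) + of_nat (k choose 2)) (N + of_nat k) + ?R"
    unfolding set(1) using mk S(2) by simp
  ultimately show ?case
    unfolding mk S(1) by simp
qed

section \<open>From the algebraic recurrence to permutations\<close>

text \<open>Intended as the generating function of the 312-counts of \<open>p\<close> and its
  descendants, with \<open>x\<close> marking the depth below \<open>p\<close>.\<close>

definition perm_weight :: "'a::comm_ring_1 \<Rightarrow> 'a \<Rightarrow> nat list \<Rightarrow> 'a" where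
  "perm_weight C u p = weight C u (Suc (length p) - max_bottom p) (of_nat (occ_count [3,1,2] p))
     (\<Sum>v\<in>{max_bottom p<..length p}. of_nat (ascents_below v p)) (of_nat (ascents_below (Suc (length p)) p))"

lemma perm_weight_insert_front:
  assumes p: "p \<in> Av n [1,2,3]" and w: "max_bottom p < w" "w \<le> n"
  shows "perm_weight C u (insert_front w p) = weight C u (n + 2 - w)
    (of_nat (occ_count [3,1,2] p) + of_nat (ascents_below w p))
    ((\<Sum>v\<in>{w..n}. of_nat (ascents_below v p)) + of_nat (Suc n - w choose 2))
    (of_nat (ascents_below (Suc n) p) + of_nat (Suc n - w))"
proof -
  \<comment> \<open>The child has maximal bottom \<open>w\<close> and length \<open>Suc n\<close>.
    Moving \<open>v\<close> down by one matches its ascent counts with those of \<open>p\<close>,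
    and the surplus \<open>0 + 1 + ... + (n - w)\<close> gives the binomial coefficient.\<close>
  have "(\<Sum>v\<in>{w<..Suc n}. of_nat (ascents_below v (insert_front w p))) =
      (\<Sum>v\<in>{w..n}. of_nat (ascents_below (Suc v) (insert_front w p)) :: 'a)"
    by (rule sum.reindex_bij_witness[of _ Suc "\<lambda>v. v - 1"]) auto
  also have "\<dots> = (\<Sum>v\<in>{w..n}. of_nat (ascents_below v p) + of_nat (v - w))"
    using w by (intro sum.cong refl) (subst ascents_below_insert_front[OF p], auto)
  also have "\<dots> = (\<Sum>v\<in>{w..n}. of_nat (ascents_below v p)) + of_nat (\<Sum>v\<in>{w..n}. v - w)"
    by (simp add: sum.distrib)
  also have "(\<Sum>v\<in>{w..n}. v - w) = \<Sum>{..<Suc n - w}"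
    by (rule sum.reindex_bij_witness[of _ "\<lambda>v. v + w" "\<lambda>v. v - w"]) auto
  also have "\<dots> = (Suc n - w choose 2)"
    by (simp add: Sum_Ico_nat choose_two lessThan_atLeast0)
  finally have S: "(\<Sum>v\<in>{w<..Suc n}. of_nat (ascents_below v (insert_front w p))) =
    (\<Sum>v\<in>{w..n}. of_nat (ascents_below v p)) + (of_nat (Suc n - w choose 2) :: 'a)" .
  have occ: "occ_count [3,1,2] (insert_front w p) = occ_count [3,1,2] p + ascents_below w p"
    using w by (intro occ_count_312_insert_front[OF p]) auto
  have "ascents_below (Suc (Suc n)) (insert_front w p) = ascents_below (Suc n) p + (Suc n - w)"
    using w by (subst ascents_below_insert_front[OF p]) auto
  thus ?thesis
    using w S unfolding perm_weight_def length_insert_front[OF p] max_bottom_insert_front[OF p w(1) le_SucI[OF w(2)]] occ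
    by (simp add: algebra_simps)
qed

text \<open>A new maximum in front starts no ascending pair: \<open>m\<close> stays, the number of
  admissible values grows by one, and the sum gains the term at \<open>v = Suc n\<close>.\<close>

lemma perm_weight_insert_front_max:
  assumes p: "p \<in> Av n [1,2,3]"
  shows "perm_weight C u (insert_front (Suc n) p) = weight C u (n + 2 - max_bottom p)
    (of_nat (occ_count [3,1,2] p) + of_nat (ascents_below (Suc n) p))
    ((\<Sum>v\<in>{max_bottom p<..n}. of_nat (ascents_below v p)) + of_nat (ascents_below (Suc n) p))
    (of_nat (ascents_below (Suc n) p))"
proof -
  have m: "max_bottom p \<le> n"
    using p by (intro max_bottom_le) (auto simp: Av_iff)
  have "(\<Sum>v\<in>{max_bottom p<..Suc n}. of_nat (ascents_below v (insert_front (Suc n) p))) =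
      (\<Sum>v\<in>{max_bottom p<..Suc n}. of_nat (ascents_below v p) :: 'a)"
    by (intro sum.cong refl) (simp add: ascents_below_insert_front_max[OF p])
  also have "\<dots> = (\<Sum>v\<in>insert (Suc n) {max_bottom p<..n}. of_nat (ascents_below v p))"
    using m by (intro sum.cong) auto
  finally have S: "(\<Sum>v\<in>{max_bottom p<..Suc n}. of_nat (ascents_below v (insert_front (Suc n) p))) =
    (\<Sum>v\<in>{max_bottom p<..n}. of_nat (ascents_below v p)) + (of_nat (ascents_below (Suc n) p) :: 'a)"
    by (simp add: add.commute)
  have occ: "occ_count [3,1,2] (insert_front (Suc n) p) = occ_count [3,1,2] p + ascents_below (Suc n) p"
    by (rule occ_count_312_insert_front[OF p]) simp
  have N: "ascents_below (Suc (Suc n)) (insert_front (Suc n) p) = ascents_below (Suc n) p"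
    by (subst ascents_below_insert_front[OF p]) auto
  have "max_bottom (insert_front (Suc n) p) = max_bottom p"
    using m max_bottom_insert_front[OF p, of "Suc n"] by simp
  thus ?thesis
    using S N unfolding perm_weight_def length_insert_front[OF p] occ
    by simp
qed

lemma perm_weight_recurrence:
  fixes C u x :: "'a::idom"
  assumes C: "C * (1 + u) = 1 + 2 * u" and x: "x * C^2 = C - 1" and p: "p \<in> Av n [1,2,3]"
  shows "perm_weight C u p = of_nat (occ_count [3,1,2] p) +
    x * (\<Sum>v\<in>{max_bottom p<..Suc n}. perm_weight C u (insert_front v p))"
proof -
  have m: "max_bottom p \<le> n"
    using p by (intro max_bottom_le) (auto simp: Av_iff)
  have "{max_bottom p<..Suc n} = insert (Suc n) {max_bottom p<..n}"
    using m by auto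
  hence "(\<Sum>v\<in>{max_bottom p<..Suc n}. perm_weight C u (insert_front v p)) =
      (\<Sum>v\<in>{max_bottom p<..n}. perm_weight C u (insert_front v p)) + perm_weight C u (insert_front (Suc n) p)"
    by (simp add: add.commute)
  also have "(\<Sum>v\<in>{max_bottom p<..n}. perm_weight C u (insert_front v p)) =
      (\<Sum>w\<in>{max_bottom p<..n}. weight C u (n + 2 - w)
        (of_nat (occ_count [3,1,2] p) + of_nat (ascents_below w p))
        ((\<Sum>v\<in>{w..n}. of_nat (ascents_below v p)) + of_nat (Suc n - w choose 2))
        (of_nat (ascents_below (Suc n) p) + of_nat (Suc n - w)))"
    by (intro sum.cong refl perm_weight_insert_front[OF p]) auto
  finally show ?thesis
    unfolding perm_weight_insert_front_max[OF p]
    using weight_recurrence[OF C x m] by (simp only: perm_weight_def length_Av[OF p])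
qed

text \<open>Summed over a level of the tree, the recurrence refers to the next level with one factor
  \<open>fps_X\<close>; so coefficient \<open>d\<close> at level \<open>n\<close> is the constant
  term at level \<open>n + d\<close>.\<close>

lemma sum_perm_weight_nth:
  fixes C u :: "'a::idom fps"
  assumes C: "C * (1 + u) = 1 + 2 * u" and x: "fps_X * C^2 = C - 1"
  shows "fps_nth (\<Sum>p\<in>Av n [1,2,3]. perm_weight C u p) d = of_nat (total_occ [3,1,2] (Av (n + d) [1,2,3]))"
proof -
  have rec: "(\<Sum>p\<in>Av n [1,2,3]. perm_weight C u p) = of_nat (total_occ [3,1,2] (Av n [1,2,3])) +
    fps_X * (\<Sum>p\<in>Av (Suc n) [1,2,3]. perm_weight C u p)" for n
  proof -
    have "(\<Sum>p\<in>Av n [1,2,3]. perm_weight C u p) = of_nat (total_occ [3,1,2] (Av n [1,2,3])) +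
      fps_X * (\<Sum>p\<in>Av n [1,2,3]. \<Sum>v\<in>{max_bottom p<..Suc n}. perm_weight C u (insert_front v p))"
      by (simp add: perm_weight_recurrence[OF C x] sum.distrib sum_distrib_left total_occ_def cong: sum.cong)
    also have "(\<Sum>p\<in>Av n [1,2,3]. \<Sum>v\<in>{max_bottom p<..Suc n}. perm_weight C u (insert_front v p)) =
        (\<Sum>(p, v)\<in>(SIGMA p:Av n [1,2,3]. {max_bottom p<..Suc n}). perm_weight C u (insert_front v p))"
      by (rule sum.Sigma) auto
    also have "\<dots> = (\<Sum>p\<in>Av (Suc n) [1,2,3]. perm_weight C u p)"
      using sum.reindex_bij_betw[OF bij_betw_insert_front, of "perm_weight C u" n]
      by (simp add: case_prod_unfold)
    finally show ?thesis .
  qed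
  show ?thesis
  proof (induction d arbitrary: n)
    case 0
    show ?case by (subst rec) simp
  next
    case (Suc d)
    show ?case by (subst rec) (simp add: Suc.IH del: One_nat_def)
  qed
qed

text \<open>Level 0 consists of the empty permutation, with \<open>k = 1\<close> and all other
  statistics 0.\<close>

lemma gf_total_occ_312:
  fixes C u :: "'a::idom fps"
  assumes C: "C * (1 + u) = 1 + 2 * u" and x: "fps_X * C^2 = C - 1"
  shows "Abs_fps (\<lambda>n. of_nat (total_occ [3,1,2] (Av n [1,2,3]))) = u^3 * (1 + 2 * u)"
proof -
  have "p \<in> Av 0 [1,2,3] \<longleftrightarrow> p = []" for p
    unfolding Av_iff avoids_iff occurrences_123 by auto
  hence "Av 0 [1,2,3] = {[]}" by blast
  moreover have "perm_weight C u [] = u^3 * (1 + 2 * u)"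
  proof -
    have "occ_count [3,1,2] [] = 0" "ascents_below v [] = 0" for v
      unfolding occ_count_def occurrences_312 ascents_below_def by (auto simp: card_eq_0_iff)
    hence "perm_weight C u [] = C * (u^2 * (u + u^2))"
      by (simp add: perm_weight_def weight_def eval_nat_numeral)
    also have "\<dots> = u^3 * (C * (1 + u))" by algebra
    finally show ?thesis unfolding C .
  qed
  ultimately show ?thesis
    using sum_perm_weight_nth[OF C x, of 0] by (auto intro!: fps_ext)
qed

subsection \<open>The closed form\<close>

lemma one_minus_4x_powr_add:
  "one_minus_4x_powr (a + b) = one_minus_4x_powr a * one_minus_4x_powr b"
  unfolding one_minus_4x_powr_def fps_binomial_add_mult by (rule fps_compose_mult_distrib) simp

lemma one_minus_4x_powr_1: "one_minus_4x_powr 1 = 1 - 4 * fps_X"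
  by (simp add: one_minus_4x_powr_def fps_binomial_1 fps_compose_add_distrib)

theorem corollary20:
  shows "(\<forall>n. total_occ [2,3,1] (Av n [1,2,3]) = total_occ [3,1,2] (Av n [1,2,3])) \<and>
    Abs_fps (\<lambda>n. of_nat (total_occ [2,3,1] (Av n [1,2,3]))) =
      (1 - 3 * fps_X) / (2 * (1 - 4 * fps_X)^2) -
      (4 * fps_X^2 - 5 * fps_X + 1) / (2 * one_minus_4x_powr (5/2))"
proof -
  define s where "s = one_minus_4x_powr (1/2)"
  define t where "t = inverse s"
  \<comment> \<open>Writing one half as a ring element with \<open>2 * h = 1\<close> keeps all later
    identities within reach of \<open>algebra\<close>.\<close>
  define h :: "rat fps" where "h = fps_const (1/2)"
  define u where "u = h * (t - 1)"
  define C where "C = (1 + 2 * u) * inverse (1 + u)"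
  have s2: "s^2 = 1 - 4 * fps_X"
    using one_minus_4x_powr_add[of "1/2" "1/2"] by (simp add: s_def power2_eq_square one_minus_4x_powr_1)
  have s5: "one_minus_4x_powr (5/2) = s^5"
  proof -
    have "one_minus_4x_powr (5/2) = one_minus_4x_powr (1/2) * one_minus_4x_powr 1 * one_minus_4x_powr 1"
      by (simp flip: one_minus_4x_powr_add)
    thus ?thesis
      unfolding one_minus_4x_powr_1 s2[symmetric] s_def[symmetric] by algebra
  qed
  have s0: "fps_nth s 0 = 1"
    by (simp add: s_def one_minus_4x_powr_def)
  have st: "s * t = 1"
    unfolding t_def using s0 by (simp add: inverse_mult_eq_1')
  have h: "2 * h = 1"
    by (simp add: h_def fps_eq_iff fps_numeral_nth)
  have t0: "fps_nth t 0 = 1"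
    by (simp add: t_def s0)
  have u0: "fps_nth u 0 = 0"
    by (simp add: u_def h_def t0)
  have t: "t = 1 + 2 * u"
    using h unfolding u_def by algebra
  have "inverse (1 + u) * (1 + u) = 1"
    by (rule inverse_mult_eq_1) (simp add: u0)
  hence C: "C * (1 + u) = 1 + 2 * u"
    unfolding C_def by (simp add: mult.assoc)
  \<comment> \<open>Both sides equal \<open>t^2 - 1\<close>, since
    \<open>4 * fps_X = 1 - s^2\<close>.\<close>
  have "4 * (fps_X * t^2) = 4 * (u * (1 + u))"
    using s2 st t by algebra
  hence Xt: "fps_X * t^2 = u * (1 + u)"
    by simp
  \<comment> \<open>Both sides equal \<open>u * (1 + u)\<close>; cancelling the square yields the
    Catalan equation.\<close>
  from Xt have "(fps_X * C^2) * (1 + u)^2 = (C - 1) * (1 + u)^2"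
    using C t by algebra
  moreover have "(1 + u)^2 \<noteq> 0"
    using u0 by (auto dest!: arg_cong[where f = "\<lambda>f. fps_nth f 0"])
  ultimately have x: "fps_X * C^2 = C - 1"
    by simp
  have "(1 - 3 * fps_X) / (2 * (1 - 4 * fps_X)^2) - (4 * fps_X^2 - 5 * fps_X + 1) / (2 * one_minus_4x_powr (5/2))
      = (1 - 3 * fps_X) * (h * t^4) - (4 * fps_X^2 - 5 * fps_X + 1) * (h * t^5)"
  proof -
    \<comment> \<open>The denominators are units with explicit inverses, so division becomes
      multiplication.\<close>
    have divide: "a / b = a * c" if "b * c = 1" for a b c :: "rat fps"
    proof -
      have "a = a * c * b" "b \<noteq> 0"
        using that by (auto simp: ac_simps)
      thus ?thesis by (metis nonzero_mult_div_cancel_right)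
    qed
    have "2 * (1 - 4 * fps_X)^2 * (h * t^4) = 1" "2 * one_minus_4x_powr (5/2) * (h * t^5) = 1"
      unfolding s2[symmetric] s5 using st h by algebra+
    thus ?thesis by (simp only: divide)
  qed
  \<comment> \<open>The quadratic factors as \<open>(1 - fps_X) * (1 - 4 * fps_X)\<close>, and the
    second factor is \<open>s^2\<close>.\<close>
  also have "(4 * fps_X^2 - 5 * fps_X + 1) * (h * t^5) = (1 - fps_X) * (h * t^3)"
    using s2 st by algebra
  \<comment> \<open>Replacing \<open>fps_X * t^2\<close> by \<open>u * (1 + u)\<close> leaves
    \<open>h * t\<close> times \<open>t * (1 + u + u^2) - (1 + 3 * u + 3 * u^2)\<close>, and this
    difference is \<open>2 * u^3\<close>.\<close>
  also have "(1 - 3 * fps_X) * (h * t^4) - (1 - fps_X) * (h * t^3) = u^3 * (1 + 2 * u)"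
    using Xt t h by algebra
  finally show ?thesis
    using gf_total_occ_312[OF C x] unfolding total_occ_231_eq_312 by metis
qed

end
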